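(* The set $\mathcal{D}$ is a non-empty, closed subset of $\mathbb{S}^{d-1}$, and $\mathbb{P}(L=\mathcal{D})=1$.
   Context: Let $d\in\mathbb{N}=\{1,2,3,\ldots\}$. Let $X,X_1,X_2,\ldots$ be i.i.d. random variables in $\mathbb{R}^d$, and let $S_0=\mathbf{0}$, $S_n=\sum_{k=1}^n X_k$ for $n\ge 1$, be the associated random walk. Standing assumption: the walk is genuinely $d$-dimensional, i.e. $\operatorname{supp}X$ is not contained in a $(d-1)$-dimensional (linear) subspace of $\mathbb{R}^d$. Here $\|\cdot\|$ is the Euclidean norm, $\mathbb{S}^{d-1}=\{\mathbf{x}\in\mathbb{R}^d:\|\mathbf{x}\|=1\}$, $\hat{\mathbf{x}}=\mathbf{x}/\|\mathbf{x}\|$ for $\mathbf{x}\neq\mathbf{0}$, and $\hat{\mathbf{0}}=\mathbf{0}$; write $\hat S_n$ for the image of $S_n$ under this map. The random set of recurrent directions is $L=\{\mathbf{u}\in\mathbb{S}^{d-1}:\liminf_{n\to\infty}\|\hat S_n-\mathbf{u}\|=0\}$, and the non-random set of a.s. recurrent directions is $\mathcal{D}=\{\mathbf{u}\in\mathbb{S}^{d-1}:\liminf_{n\to\infty}\|\hat S_n-\mathbf{u}\|=0 \text{ almost surely}\}$. *)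

theory Defs
  imports "HOL-Probability.Probability"
begin

text \<open>
  Topological support of the law of a random variable: all points each of whose open
  neighbourhoods is charged by the law.
\<close>

definition law_support :: "'w measure \<Rightarrow> ('w \<Rightarrow> 'a::topological_space) \<Rightarrow> 'a set" where
  "law_support M X = {x. \<forall>U. open U \<and> x \<in> U \<longrightarrow> measure (distr M borel X) U > 0}"

definition genuinely_full_dim :: "'w measure \<Rightarrow> ('w \<Rightarrow> 'a::euclidean_space) \<Rightarrow> bool" where
  "genuinely_full_dim M X \<longleftrightarrow>
     \<not> (\<exists>V. subspace V \<and> dim V = DIM('a) - 1 \<and> law_support M X \<subseteq> V)"

text \<open>The increments are indexed from 1; the value at index 0 is never used.\<close>

definition walk :: "(nat \<Rightarrow> 'w \<Rightarrow> 'a::comm_monoid_add) \<Rightarrow> nat \<Rightarrow> 'w \<Rightarrow> 'a" where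
  "walk Xs n \<omega> = (\<Sum>k=1..n. Xs k \<omega>)"

text \<open>
  The normalisation map is the library's \<^term>\<open>sgn\<close>: on a real normed vector space it sends
  \<open>x\<close> to \<open>x /\<^sub>R norm x\<close>, and \<open>0\<close> to \<open>0\<close>. The lower limit is taken in the extended reals
  because \<^term>\<open>liminf\<close> needs a complete lattice.
\<close>

definition recurrent_direction ::
  "(nat \<Rightarrow> 'w \<Rightarrow> 'a::real_normed_vector) \<Rightarrow> 'w \<Rightarrow> 'a \<Rightarrow> bool" where
  "recurrent_direction Xs \<omega> u \<longleftrightarrow>
     liminf (\<lambda>n. ereal (norm (sgn (walk Xs n \<omega>) - u))) = 0"

definition recurrent_directions ::
  "(nat \<Rightarrow> 'w \<Rightarrow> 'a::real_normed_vector) \<Rightarrow> 'w \<Rightarrow> 'a set" where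
  "recurrent_directions Xs \<omega> = {u \<in> sphere 0 1. recurrent_direction Xs \<omega> u}"

definition as_recurrent_directions ::
  "'w measure \<Rightarrow> (nat \<Rightarrow> 'w \<Rightarrow> 'a::real_normed_vector) \<Rightarrow> 'a set" where
  "as_recurrent_directions M Xs =
     {u \<in> sphere 0 1. AE \<omega> in M. recurrent_direction Xs \<omega> u}"

end

theory Submission
  imports Defs
begin

text \<open>
  Whether the direction of the walk lies in a given Borel set infinitely often does not change
  when finitely many increments are permuted, because from some time on the walk has the same
  position as before. By the argument of Hewitt and
  Savage such an event has probability 0 or 1 (\<open>zero_one_law_visits\<close>). The tail zero-one law of
  Kolmogorov would not suffice, because altering finitely many increments shifts the whole
  walk, and a recurrent walk notices the shift.

  Everything else is compactness and countability. If a unit vector is not an almost surely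
  recurrent direction, then by the zero-one law some ball around it is almost surely visited
  only finitely often. Finitely many such balls cover the unit vectors in a closed set that
  contains neither 0 nor an almost surely recurrent direction, so such a set is itself visited
  only finitely often (\<open>AE_not_visits_closed\<close>). Applied to the whole sphere this shows that almost
  surely recurrent directions exist: otherwise the walk would eventually sit at the origin,
  whereas a non-degenerate increment moves it away from there at arbitrarily late times with
  probability bounded below.

  The set of limit directions is closed, hence determined by which closures of sets
  from a countable basis are visited infinitely often (\<open>accumulation_set_eq_iff\<close>). For each of them the
  two facts above give the right answer almost surely. The same countable description makes the
  event that the random set equals the deterministic one measurable.
\<close>

section \<open>Recurrent directions as accumulation points\<close>

lemma recurrent_direction_iff:
  "recurrent_direction Xs \<omega> u \<longleftrightarrow>
    (\<forall>e>0. \<exists>\<^sub>F n in sequentially. sgn (walk Xs n \<omega>) \<in> ball u e)"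
proof -
  let ?f = "\<lambda>n. norm (sgn (walk Xs n \<omega>) - u)"
  have "0 \<le> liminf (\<lambda>n. ereal (?f n))"
    by (intro Liminf_bounded always_eventually) auto
  then have "recurrent_direction Xs \<omega> u \<longleftrightarrow> \<not> 0 < liminf (\<lambda>n. ereal (?f n))"
    by (auto simp: recurrent_direction_def)
  also have "\<dots> \<longleftrightarrow> \<not> (\<exists>e>0. \<forall>\<^sub>F n in sequentially. e \<le> ?f n)"
  proof -
    have "0 < liminf (\<lambda>n. ereal (?f n)) \<longleftrightarrow> (\<exists>e>0. \<forall>\<^sub>F n in sequentially. e \<le> ?f n)"
    proof
      assume "0 < liminf (\<lambda>n. ereal (?f n))"
      then obtain e where e: "0 < ereal e" "ereal e < liminf (\<lambda>n. ereal (?f n))"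
        using ereal_dense2 by blast
      then show "\<exists>e>0. \<forall>\<^sub>F n in sequentially. e \<le> ?f n"
        using less_LiminfD[OF e(2)] by (auto elim!: eventually_mono intro!: exI[of _ e])
    next
      assume "\<exists>e>0. \<forall>\<^sub>F n in sequentially. e \<le> ?f n"
      then obtain e where e: "e > 0" "\<forall>\<^sub>F n in sequentially. e \<le> ?f n" by blast
      have "ereal e \<le> liminf (\<lambda>n. ereal (?f n))"
        by (intro Liminf_bounded eventually_mono[OF e(2)]) auto
      with e(1) show "0 < liminf (\<lambda>n. ereal (?f n))"
        by (metis ereal_less(2) order_less_le_trans)
    qed
    then show ?thesis by simp
  qed
  finally show ?thesis
    by (simp add: frequently_def dist_norm norm_minus_commute not_less) (meson not_le)
qed

text \<open>
  This turns an equality of uncountable sets into countably many conditions when the basis is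
  countable. Basic sets that meet \<open>D\<close> force \<open>D\<close> into the set of accumulation points; basic sets
  whose closure misses \<open>D\<close> keep other points out. Closures appear because visiting a closed part
  of the compact set \<open>K\<close> infinitely often yields an accumulation point in it. The isolated
  extra value \<open>z\<close> is there for the direction 0 that the walk has at the origin.
\<close>

lemma accumulation_set_eq_iff:
  fixes s :: "nat \<Rightarrow> 'a::metric_space"
  assumes basis: "topological_basis \<B>" and K: "compact K" "z \<notin> K"
    and s: "\<And>n. s n \<in> insert z K" and D: "closed D" "D \<subseteq> K"
  shows "{u \<in> K. \<forall>e>0. \<exists>\<^sub>F n in sequentially. s n \<in> ball u e} = D \<longleftrightarrow>
    (\<forall>B\<in>\<B>. (D \<inter> B \<noteq> {} \<longrightarrow> (\<exists>\<^sub>F n in sequentially. s n \<in> closure B)) \<and>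
      (z \<notin> closure B \<and> D \<inter> closure B = {} \<longrightarrow> \<not> (\<exists>\<^sub>F n in sequentially. s n \<in> closure B)))"
    (is "?L = D \<longleftrightarrow> ?R")
proof
  assume L: "?L = D"
  show ?R
  proof (intro ballI conjI impI)
    fix B assume B: "B \<in> \<B>" "D \<inter> B \<noteq> {}"
    then obtain u where u: "u \<in> ?L" "u \<in> B" using L by blast
    obtain e where e: "e > 0" "ball u e \<subseteq> B"
      using topological_basis_open[OF basis B(1)] u(2) open_contains_ball by blast
    with u have "\<exists>\<^sub>F n in sequentially. s n \<in> ball u e" by blast
    then show "\<exists>\<^sub>F n in sequentially. s n \<in> closure B"
      by (rule frequently_elim1) (use e(2) closure_subset in blast)
  next
    fix B assume B: "B \<in> \<B>" "z \<notin> closure B \<and> D \<inter> closure B = {}"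
    show "\<not> (\<exists>\<^sub>F n in sequentially. s n \<in> closure B)"
    proof
      assume fr: "\<exists>\<^sub>F n in sequentially. s n \<in> closure B"
      then have inf: "infinite {n. s n \<in> closure B}"
        by (simp add: cofinite_eq_sequentially[symmetric] frequently_cofinite)
      define r where "r = enumerate {n. s n \<in> closure B}"
      have r: "strict_mono r" "\<And>n. s (r n) \<in> closure B"
        using strict_mono_enumerate[OF inf] enumerate_in_set[OF inf] by (auto simp: r_def)
      have "\<And>n. s (r n) \<in> K \<inter> closure B"
        using r(2) s B(2) by (metis IntI insertE)
      moreover have "seq_compact (K \<inter> closure B)"
        using K(1) by (simp add: compact_Int_closed compact_imp_seq_compact)
      ultimately obtain u q where u: "u \<in> K \<inter> closure B" "strict_mono q"
          "((s \<circ> r) \<circ> q) \<longlonglongrightarrow> u"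
        by (metis comp_apply seq_compactE)
      have "u \<in> ?L"
      proof (intro CollectI conjI allI impI)
        fix e :: real assume "e > 0"
        with u(3) have "\<forall>\<^sub>F n in sequentially. s ((r \<circ> q) n) \<in> ball u e"
          by (auto simp: tendsto_iff dist_commute)
        moreover have "filterlim (r \<circ> q) sequentially sequentially"
          using r(1) u(2) by (intro filterlim_subseq strict_mono_o)
        ultimately have "\<exists>\<^sub>F n in filtermap (r \<circ> q) sequentially. s n \<in> ball u e"
          by (simp add: frequently_filtermap eventually_frequently)
        then show "\<exists>\<^sub>F n in sequentially. s n \<in> ball u e"
          using \<open>filterlim (r \<circ> q) sequentially sequentially\<close>
          by (auto simp: filterlim_def le_filter_def frequently_def)
      qed (use u in auto)
      with L B(2) u(1) show False by blast
    qed
  qed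
next
  assume R: ?R
  have small: "\<exists>B\<in>\<B>. u \<in> B \<and> closure B \<subseteq> U" if U: "open U" "u \<in> U" for u U
  proof -
    obtain e where e: "e > 0" "cball u e \<subseteq> U" using U open_contains_cball by blast
    obtain B where "B \<in> \<B>" "u \<in> B" "B \<subseteq> ball u e"
      using topological_basisE[OF basis, of "ball u e" u] e(1) by auto
    moreover from this have "closure B \<subseteq> cball u e"
      by (intro closure_minimal) (auto simp: subset_eq less_imp_le)
    ultimately show ?thesis using e(2) by blast
  qed
  show "?L = D"
  proof (intro equalityI subsetI)
    fix u assume u: "u \<in> ?L"
    show "u \<in> D"
    proof (rule ccontr)
      assume "u \<notin> D"
      with u K(2) have "u \<in> - insert z D" by auto
      moreover have "open (- insert z D)" using D(1) by auto
      ultimately obtain B where B: "B \<in> \<B>" "u \<in> B" "closure B \<subseteq> - insert z D"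
        using small by blast
      then obtain e where e: "e > 0" "ball u e \<subseteq> B"
        using topological_basis_open[OF basis B(1)] open_contains_ball by blast
      with u have "\<exists>\<^sub>F n in sequentially. s n \<in> ball u e" by blast
      then have "\<exists>\<^sub>F n in sequentially. s n \<in> closure B"
        by (rule frequently_elim1) (use e(2) closure_subset in blast)
      with R B show False by blast
    qed
  next
    fix u assume u: "u \<in> D"
    show "u \<in> ?L"
    proof (intro CollectI conjI allI impI)
      fix e :: real assume "e > 0"
      then obtain B where B: "B \<in> \<B>" "u \<in> B" "closure B \<subseteq> ball u e"
        using small[of "ball u e" u] by auto
      with R u have "\<exists>\<^sub>F n in sequentially. s n \<in> closure B" by blast
      then show "\<exists>\<^sub>F n in sequentially. s n \<in> ball u e"
        by (rule frequently_elim1) (use B(3) in blast)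
    qed (use u D in auto)
  qed
qed

section \<open>The zero-one law for visits of a random walk\<close>

text \<open>
  The joint law of an i.i.d. family is a power of a single law, and such a power does not
  notice an injective relabelling of its coordinates.
\<close>

lemma (in prob_space) distr_iid_reindex:
  fixes N :: "'b measure" and Xs :: "'i \<Rightarrow> 'a \<Rightarrow> 'b"
  assumes indep: "indep_vars (\<lambda>_. N) Xs I" and I: "I \<noteq> {}"
    and ident: "\<And>i. i \<in> I \<Longrightarrow> distr M N (Xs i) = \<mu>"
    and \<pi>: "inj_on \<pi> I" "\<pi> ` I \<subseteq> I"
  shows "distr M (PiM I (\<lambda>_. N)) (\<lambda>\<omega>. \<lambda>i\<in>I. Xs (\<pi> i) \<omega>) =
    distr M (PiM I (\<lambda>_. N)) (\<lambda>\<omega>. \<lambda>i\<in>I. Xs i \<omega>)"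
proof -
  have \<pi>I: "\<pi> i \<in> I" if "i \<in> I" for i using \<pi>(2) that by blast
  have rv: "random_variable N (Xs i)" if "i \<in> I" for i
    using indep that by (auto simp: indep_vars_def)
  obtain i0 where "i0 \<in> I" using I by blast
  then have \<mu>: "prob_space \<mu>" "sets \<mu> = sets N"
    using ident prob_space_distr rv by (metis, metis sets_distr)
  have joint: "distr M (PiM I (\<lambda>_. N)) (\<lambda>\<omega>. \<lambda>i\<in>I. Xs i \<omega>) = PiM I (\<lambda>_. \<mu>)"
    using indep_vars_iff_distr_eq_PiM'[OF I, of Xs "\<lambda>_. N"] rv indep ident
    by (simp cong: PiM_cong)
  have sets: "sets (PiM I (\<lambda>_. \<mu>)) = sets (PiM I (\<lambda>_. N))"
    by (intro sets_PiM_cong) (auto simp: \<mu>)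
  have meas: "(\<lambda>x. \<lambda>i\<in>I. x (\<pi> i)) \<in> PiM I (\<lambda>_. N) \<rightarrow>\<^sub>M PiM I (\<lambda>_. N)"
    using \<pi>(2) by (intro measurable_restrict measurable_component_singleton) auto
  have "distr M (PiM I (\<lambda>_. N)) (\<lambda>\<omega>. \<lambda>i\<in>I. Xs (\<pi> i) \<omega>) =
      distr (distr M (PiM I (\<lambda>_. N)) (\<lambda>\<omega>. \<lambda>i\<in>I. Xs i \<omega>)) (PiM I (\<lambda>_. N)) (\<lambda>x. \<lambda>i\<in>I. x (\<pi> i))"
    by (subst distr_distr[OF meas])
      (auto intro!: distr_cong measurable_restrict rv simp: fun_eq_iff \<pi>I)
  also have "\<dots> = distr (PiM I (\<lambda>_. \<mu>)) (PiM I (\<lambda>_. \<mu>)) (\<lambda>x. \<lambda>i\<in>I. x (\<pi> i))"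
    by (simp add: joint sets cong: distr_cong)
  also have "\<dots> = PiM I (\<lambda>_. \<mu>)"
    using distr_PiM_reindex[of I "\<lambda>_. \<mu>" \<pi> I] \<mu>(1) \<pi> by (auto simp: image_subset_iff_funcset)
  finally show ?thesis using joint by simp
qed

text \<open>
  Exchanging the first two blocks of length \<open>K\<close> turns the first \<open>K\<close> steps into an independent
  copy of them, yet changes no position of the walk from time \<open>2 * K\<close> on.
\<close>

definition swap_blocks :: "nat \<Rightarrow> nat \<Rightarrow> nat" where
  "swap_blocks K i = (if i \<in> {1..K} then i + K else if i \<in> {K + 1..2 * K} then i - K else i)"

lemma bij_betw_swap_blocks: "bij_betw (swap_blocks K) {1..} {1..}"
  by (rule bij_betw_byWitness[where f' = "swap_blocks K"]) (auto simp: swap_blocks_def)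

lemma walk_swap_blocks:
  assumes "2 * K \<le> n"
  shows "walk (\<lambda>k. Xs (swap_blocks K k)) n \<omega> = walk Xs n \<omega>"
  unfolding walk_def using assms
  by (intro sum.reindex_bij_witness[where i = "swap_blocks K" and j = "swap_blocks K"])
    (auto simp: swap_blocks_def)

locale iid_walk = prob_space M for M :: "'w measure" +
  fixes Xs :: "nat \<Rightarrow> 'w \<Rightarrow> 'a::euclidean_space" and \<mu> :: "'a measure"
  assumes indep: "indep_vars (\<lambda>_. borel) Xs {1..}"
    and ident: "\<And>k. 1 \<le> k \<Longrightarrow> distr M borel (Xs k) = \<mu>"
begin

lemma measurable_increment [measurable]: "1 \<le> k \<Longrightarrow> Xs k \<in> borel_measurable M"
  using indep by (auto simp: indep_vars_def)

lemma measurable_walk [measurable]: "walk Xs n \<in> borel_measurable M"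
  unfolding walk_def by (intro borel_measurable_sum) auto

lemma prob_swap_blocks:
  assumes "Measurable.pred (PiM {1..} (\<lambda>_. borel)) P"
  shows "prob {\<omega> \<in> space M. P (\<lambda>i\<in>{1..}. Xs (swap_blocks K i) \<omega>)} =
    prob {\<omega> \<in> space M. P (\<lambda>i\<in>{1..}. Xs i \<omega>)}"
proof -
  let ?N = "PiM {1..} (\<lambda>_. borel) :: (nat \<Rightarrow> 'a) measure"
  have G: "{x \<in> space ?N. P x} \<in> sets ?N" using assms by measurable
  have \<pi>: "swap_blocks K i \<ge> 1" if "i \<ge> 1" for i
    using that bij_betw_swap_blocks[of K] by (auto simp: bij_betw_def)
  have eq: "measure (distr M ?N (\<lambda>\<omega>. \<lambda>i\<in>{1..}. Xs (\<sigma> i) \<omega>)) {x \<in> space ?N. P x} =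
      prob {\<omega> \<in> space M. P (\<lambda>i\<in>{1..}. Xs (\<sigma> i) \<omega>)}"
    if \<sigma>: "\<And>i. i \<ge> 1 \<Longrightarrow> \<sigma> i \<ge> 1" for \<sigma> :: "nat \<Rightarrow> nat"
    using \<sigma> by (subst measure_distr[OF _ G])
      (auto intro!: measurable_restrict arg_cong[where f = prob] simp: space_PiM)
  show ?thesis
    using eq[of "swap_blocks K"] eq[of "\<lambda>i. i"] \<pi>
      distr_iid_reindex[OF indep _ ident, of "swap_blocks K"] bij_betw_swap_blocks[of K]
    by (auto simp: bij_betw_def)
qed

text \<open>
  Up to time \<open>K\<close>, the original walk uses only the first block of increments, and the exchanged walk
  only the second.
\<close>

lemma prob_visit_in_both_blocks:
  assumes [measurable]: "B \<in> sets borel"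
  shows "prob {\<omega> \<in> space M. (\<exists>m\<in>{N..K}. walk Xs m \<omega> \<in> B) \<and>
      (\<exists>m\<in>{N..K}. walk (\<lambda>i. Xs (swap_blocks K i)) m \<omega> \<in> B)} =
    prob {\<omega> \<in> space M. \<exists>m\<in>{N..K}. walk Xs m \<omega> \<in> B} *
    prob {\<omega> \<in> space M. \<exists>m\<in>{N..K}. walk (\<lambda>i. Xs (swap_blocks K i)) m \<omega> \<in> B}"
proof -
  let ?P = "\<lambda>J. PiM J (\<lambda>_. borel) :: (nat \<Rightarrow> 'a) measure"
  let ?I = "{1..K}" and ?J = "{K + 1..2 * K}"
  let ?X = "\<lambda>A \<omega>. restrict (\<lambda>i. Xs i \<omega>) A"
  have ind: "indep_var (?P ?I) (?X ?I) (?P ?J) (?X ?J)"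
    using indep by (rule indep_var_restrict) auto
  define G where "G = {x \<in> space (?P ?I). \<exists>m\<in>{N..K}. (\<Sum>k=1..m. x k) \<in> B}"
  define H where "H = {x \<in> space (?P ?J). \<exists>m\<in>{N..K}. (\<Sum>k=1..m. x (k + K)) \<in> B}"
  have [measurable]: "(\<lambda>x. \<Sum>k=1..m. x k) \<in> borel_measurable (?P ?I)" if "m \<in> {N..K}" for m
    using that by (intro borel_measurable_sum measurable_component_singleton) auto
  have [measurable]: "(\<lambda>x. \<Sum>k=1..m. x (k + K)) \<in> borel_measurable (?P ?J)" if "m \<in> {N..K}" for m
    using that by (intro borel_measurable_sum measurable_component_singleton) auto
  have G: "G \<in> sets (?P ?I)" and H: "H \<in> sets (?P ?J)"
    unfolding G_def H_def by measurable
  have G_eq: "?X ?I \<omega> \<in> G \<longleftrightarrow> (\<exists>m\<in>{N..K}. walk Xs m \<omega> \<in> B)" for \<omega>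
    by (auto simp: G_def walk_def space_PiM intro!: bexI)
  have H_eq: "?X ?J \<omega> \<in> H \<longleftrightarrow> (\<exists>m\<in>{N..K}. walk (\<lambda>i. Xs (swap_blocks K i)) m \<omega> \<in> B)" for \<omega>
    by (auto simp: H_def walk_def swap_blocks_def space_PiM intro!: bexI)
  have "prob {\<omega> \<in> space M. ?X ?I \<omega> \<in> G \<and> ?X ?J \<omega> \<in> H} =
      prob {\<omega> \<in> space M. ?X ?I \<omega> \<in> G} * prob {\<omega> \<in> space M. ?X ?J \<omega> \<in> H}"
    using indep_varD[OF ind G H] by (simp add: vimage_def Int_def conj_commute)
  then show ?thesis unfolding G_eq H_eq .
qed

text \<open>
  The Hewitt-Savage argument with an explicit approximation. Let \<open>A\<close> be the event of infinitely many
  visits to \<open>B\<close>. For large \<open>N\<close>, and then large \<open>K\<close>, it differs little in probability from the event \<open>V\<close>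
  of a visit between the times \<open>N\<close> and \<open>K\<close>. Exchanging the blocks fixes \<open>A\<close> and carries \<open>V\<close> to an
  independent event \<open>V'\<close> that approximates \<open>A\<close> equally well. So \<open>A\<close> is nearly contained in \<open>V \<inter> V'\<close>,
  whose probability is close to the square of that of \<open>A\<close>. A probability that does not exceed its
  own square is 0 or 1.
\<close>

lemma zero_one_law_visits:
  assumes [measurable]: "B \<in> sets borel"
  shows "prob {\<omega> \<in> space M. \<exists>\<^sub>F n in sequentially. walk Xs n \<omega> \<in> B} \<in> {0, 1}"
proof -
  define A where "A = {\<omega> \<in> space M. \<exists>\<^sub>F n in sequentially. walk Xs n \<omega> \<in> B}"
  define T where "T N = {\<omega> \<in> space M. \<exists>m\<ge>N. walk Xs m \<omega> \<in> B}" for N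
  define V where "V N K = {\<omega> \<in> space M. \<exists>m\<in>{N..K}. walk Xs m \<omega> \<in> B}" for N K
  define V' where "V' N K = {\<omega> \<in> space M. \<exists>m\<in>{N..K}. walk (\<lambda>i. Xs (swap_blocks K i)) m \<omega> \<in> B}"
    for N K
  have A_eq: "A = (\<Inter>N. T N)" by (auto simp: A_def T_def frequently_sequentially)
  have T_eq: "T N = (\<Union>K. V N K)" for N
    by (auto simp: V_def T_def intro: atLeastAtMost_iff[THEN iffD2])
  have sT [measurable]: "T N \<in> events" for N unfolding T_def by measurable
  have sV [measurable]: "V N K \<in> events" for N K unfolding V_def by measurable
  have [measurable]: "Xs (swap_blocks K i) \<in> borel_measurable M" if "1 \<le> i" for K i
    using that by (auto simp: swap_blocks_def)
  have [measurable]: "walk (\<lambda>i. Xs (swap_blocks K i)) m \<in> borel_measurable M" for K m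
    unfolding walk_def by (intro borel_measurable_sum) auto
  have sV' [measurable]: "V' N K \<in> events" for N K unfolding V'_def by measurable
  have sA [measurable]: "A \<in> events" unfolding A_eq by measurable
  have [measurable]: "walk (\<lambda>i x. x i) m \<in> borel_measurable (PiM {1..} (\<lambda>_. borel :: 'a measure))" for m
    unfolding walk_def by (intro borel_measurable_sum measurable_component_singleton) auto
  have walk_restrict: "walk (\<lambda>i x. x i) m (\<lambda>i\<in>{1..}. Xs (\<sigma> i) \<omega>) = walk (\<lambda>i. Xs (\<sigma> i)) m \<omega>" for m \<sigma> \<omega>
    by (auto simp: walk_def intro!: sum.cong)

  have V'_V: "prob (V' N K) = prob (V N K)" for N K
  proof -
    have "Measurable.pred (PiM {1..} (\<lambda>_. borel)) (\<lambda>x. \<exists>m\<in>{N..K}. walk (\<lambda>i x. x i) m x \<in> B)"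
      by measurable
    from prob_swap_blocks[OF this, of K] show ?thesis
      unfolding walk_restrict V_def V'_def .
  qed
  have A_perm: "A = {\<omega> \<in> space M. \<exists>\<^sub>F n in sequentially. walk (\<lambda>i. Xs (swap_blocks K i)) n \<omega> \<in> B}" for K
  proof -
    have "(\<exists>\<^sub>F n in sequentially. walk (\<lambda>i. Xs (swap_blocks K i)) n \<omega> \<in> B) \<longleftrightarrow>
        (\<exists>\<^sub>F n in sequentially. walk Xs n \<omega> \<in> B)" for \<omega>
      by (intro frequently_cong[OF eventually_ge_at_top[of "2 * K"]]) (simp add: walk_swap_blocks)
    then show ?thesis by (simp add: A_def)
  qed
  have diff_eq: "prob (A - V' N K) = prob (A - V N K)" for N K
  proof -
    have "Measurable.pred (PiM {1..} (\<lambda>_. borel))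
        (\<lambda>x. (\<exists>\<^sub>F n in sequentially. walk (\<lambda>i x. x i) n x \<in> B) \<and>
          \<not> (\<exists>m\<in>{N..K}. walk (\<lambda>i x. x i) m x \<in> B))"
      unfolding frequently_sequentially by measurable
    from prob_swap_blocks[OF this, of K]
    have "prob {\<omega> \<in> space M. (\<exists>\<^sub>F n in sequentially. walk (\<lambda>i. Xs (swap_blocks K i)) n \<omega> \<in> B) \<and>
          \<not> (\<exists>m\<in>{N..K}. walk (\<lambda>i. Xs (swap_blocks K i)) m \<omega> \<in> B)} =
        prob {\<omega> \<in> space M. (\<exists>\<^sub>F n in sequentially. walk Xs n \<omega> \<in> B) \<and>
          \<not> (\<exists>m\<in>{N..K}. walk Xs m \<omega> \<in> B)}"
      unfolding walk_restrict .
    moreover have "A - V' N K = {\<omega> \<in> space M.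
          (\<exists>\<^sub>F n in sequentially. walk (\<lambda>i. Xs (swap_blocks K i)) n \<omega> \<in> B) \<and>
          \<not> (\<exists>m\<in>{N..K}. walk (\<lambda>i. Xs (swap_blocks K i)) m \<omega> \<in> B)}"
      unfolding A_perm[of K] V'_def by blast
    moreover have "A - V N K = {\<omega> \<in> space M. (\<exists>\<^sub>F n in sequentially. walk Xs n \<omega> \<in> B) \<and>
          \<not> (\<exists>m\<in>{N..K}. walk Xs m \<omega> \<in> B)}"
      unfolding A_def V_def by blast
    ultimately show ?thesis by simp
  qed
  have approx: "prob A \<le> (prob A + e)\<^sup>2 + 2 * e" if e: "e > 0" for e
  proof -
    have "(\<lambda>N. prob (T N)) \<longlonglongrightarrow> prob A"
      unfolding A_eq by (intro finite_Lim_measure_decseq) (auto simp: decseq_def T_def intro: order_trans)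
    then obtain N where N: "prob (T N) < prob A + e"
      using order_tendstoD(2)[of _ "prob A" sequentially "prob A + e"] e
      by (metis eventually_sequentially le_refl less_add_same_cancel1)
    have "(\<lambda>K. prob (V N K)) \<longlonglongrightarrow> prob (T N)"
      unfolding T_eq by (intro finite_Lim_measure_incseq) (force simp: incseq_def V_def)+
    then obtain K where K: "prob (V N K) > prob (T N) - e"
      using order_tendstoD(1)[of _ "prob (T N)" sequentially "prob (T N) - e"] e
      by (metis diff_less_eq eventually_sequentially le_refl less_add_same_cancel1)
    have sub: "A \<subseteq> T N" "V N K \<subseteq> T N" by (auto simp: A_eq T_eq)
    have "prob (A - V N K) \<le> prob (T N - V N K)"
      using sub by (intro finite_measure_mono) auto
    also have "\<dots> = prob (T N) - prob (V N K)"
      using sub by (intro finite_measure_Diff) auto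
    finally have d: "prob (A - V N K) \<le> e" using K by simp
    have "prob A \<le> prob ((V N K \<inter> V' N K) \<union> ((A - V N K) \<union> (A - V' N K)))"
      by (intro finite_measure_mono) auto
    also have "\<dots> \<le> prob (V N K \<inter> V' N K) + (prob (A - V N K) + prob (A - V' N K))"
      by (intro order_trans[OF measure_Un_le] add_left_mono measure_Un_le) auto
    also have "prob (V N K \<inter> V' N K) = prob (V N K) * prob (V' N K)"
    proof -
      have "V N K \<inter> V' N K = {\<omega> \<in> space M. (\<exists>m\<in>{N..K}. walk Xs m \<omega> \<in> B) \<and>
          (\<exists>m\<in>{N..K}. walk (\<lambda>i. Xs (swap_blocks K i)) m \<omega> \<in> B)}"
        unfolding V_def V'_def by blast
      then show ?thesis
        using prob_visit_in_both_blocks[OF assms, of N K] by (simp only: V_def V'_def)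
    qed
    also have "\<dots> = (prob (V N K))\<^sup>2"
      by (simp add: V'_V power2_eq_square)
    also have "\<dots> \<le> (prob A + e)\<^sup>2"
      using finite_measure_mono[OF sub(2) sT] N by (intro power_mono) auto
    finally show ?thesis using d diff_eq[of N K] by simp
  qed
  have "prob A \<le> (prob A)\<^sup>2"
  proof (rule field_le_epsilon)
    fix e :: real assume "e > 0"
    (* The error of the approximation is 2 * P(A) * d + d^2 + 2 * d, at most 5 * d if d <= 1. *)
    define d where "d = min 1 (e / 5)"
    have d: "d > 0" "d \<le> 1" "5 * d \<le> e" using \<open>e > 0\<close> by (auto simp: d_def)
    have "prob A * d \<le> d" "d * d \<le> d" using d by (auto simp: mult_left_le_one_le)
    then show "prob A \<le> (prob A)\<^sup>2 + e"
      using approx[OF d(1)] d(3) by (simp add: power2_eq_square algebra_simps)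
  qed
  then have "prob A * (1 - prob A) \<le> 0" by (simp add: power2_eq_square algebra_simps)
  then have "prob A = 0 \<or> prob A = 1"
    using prob_le_1[of A] measure_nonneg[of M A] by (auto simp: mult_le_0_iff)
  then show ?thesis by (auto simp: A_def)
qed

section \<open>Sets of directions that are visited infinitely often\<close>

lemma visits_AE_or_AE_not:
  assumes "B \<in> sets borel"
  shows "(AE \<omega> in M. \<exists>\<^sub>F n in sequentially. sgn (walk Xs n \<omega>) \<in> B) \<or>
    (AE \<omega> in M. \<not> (\<exists>\<^sub>F n in sequentially. sgn (walk Xs n \<omega>) \<in> B))"
proof -
  let ?A = "{\<omega> \<in> space M. \<exists>\<^sub>F n in sequentially. walk Xs n \<omega> \<in> sgn -` B}"
  have [measurable]: "sgn -` B \<in> sets (borel :: 'a measure)"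
    using measurable_sets[OF borel_measurable_sgn assms] by simp
  have sA: "?A \<in> events"
    unfolding frequently_sequentially by measurable
  have "prob ?A \<in> {0, 1}"
    by (rule zero_one_law_visits) measurable
  then show ?thesis
  proof
    assume "prob ?A = 0"
    then show ?thesis using prob_eq_0[OF sA] by (auto elim!: eventually_mono)
  next
    assume "prob ?A \<in> {1}"
    then show ?thesis using prob_Collect_eq_1[OF sA] by (auto elim!: eventually_mono)
  qed
qed

text \<open>
  If every ball around \<open>u\<close> had a positive probability of infinitely many visits, the zero-one law
  would turn each probability into 1, and the balls of radius \<open>1 / (k + 1)\<close> would make \<open>u\<close> almost surely
  recurrent.
\<close>

lemma AE_not_visits_ball:
  assumes u: "u \<in> sphere 0 1" "u \<notin> as_recurrent_directions M Xs"
  obtains e where "e > 0"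
    "AE \<omega> in M. \<not> (\<exists>\<^sub>F n in sequentially. sgn (walk Xs n \<omega>) \<in> ball u e)"
proof (rule ccontr)
  assume "\<not> thesis"
  with that visits_AE_or_AE_not[of "ball u e" for e]
  have *: "AE \<omega> in M. \<exists>\<^sub>F n in sequentially. sgn (walk Xs n \<omega>) \<in> ball u e" if "e > 0" for e
    using \<open>e > 0\<close> by (metis borel_open open_ball)
  have "AE \<omega> in M. \<forall>k. \<exists>\<^sub>F n in sequentially. sgn (walk Xs n \<omega>) \<in> ball u (inverse (real (Suc k)))"
    by (intro AE_all_countable[THEN iffD2] allI *) simp
  then have "AE \<omega> in M. recurrent_direction Xs \<omega> u"
  proof (rule eventually_mono)
    fix \<omega>
    assume \<omega>: "\<forall>k. \<exists>\<^sub>F n in sequentially. sgn (walk Xs n \<omega>) \<in> ball u (inverse (real (Suc k)))"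
    show "recurrent_direction Xs \<omega> u"
      unfolding recurrent_direction_iff
    proof (intro allI impI)
      fix e :: real assume "e > 0"
      then obtain k where "inverse (real (Suc k)) < e" using reals_Archimedean by blast
      then show "\<exists>\<^sub>F n in sequentially. sgn (walk Xs n \<omega>) \<in> ball u e"
        using \<omega>[rule_format, of k] by (auto elim!: frequently_elim1)
    qed
  qed
  with u show False by (simp add: as_recurrent_directions_def)
qed

lemma AE_visits_open:
  assumes "open U" "U \<inter> as_recurrent_directions M Xs \<noteq> {}"
  shows "AE \<omega> in M. \<exists>\<^sub>F n in sequentially. sgn (walk Xs n \<omega>) \<in> U"
proof -
  obtain u where u: "u \<in> U" "AE \<omega> in M. recurrent_direction Xs \<omega> u"
    using assms(2) by (auto simp: as_recurrent_directions_def)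
  obtain e where e: "e > 0" "ball u e \<subseteq> U" using assms(1) u(1) open_contains_ball by blast
  from u(2) show ?thesis
    by (rule eventually_mono)
      (use e in \<open>auto simp: recurrent_direction_iff subset_eq elim!: frequently_elim1\<close>)
qed

text \<open>
  The exceptional null set in \<open>AE_not_visits_ball\<close> depends on the point; compactness of the sphere
  leaves only finitely many of them. As \<open>C\<close> avoids 0, directions in \<open>C\<close> are unit vectors.
\<close>

lemma AE_not_visits_closed:
  assumes "closed C" "0 \<notin> C" "C \<inter> as_recurrent_directions M Xs = {}"
  shows "AE \<omega> in M. \<not> (\<exists>\<^sub>F n in sequentially. sgn (walk Xs n \<omega>) \<in> C)"
proof -
  define K where "K = C \<inter> sphere 0 1"
  have "\<forall>u\<in>K. \<exists>e>0. AE \<omega> in M. \<not> (\<exists>\<^sub>F n in sequentially. sgn (walk Xs n \<omega>) \<in> ball u e)"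
    using assms(3) AE_not_visits_ball unfolding K_def by (metis IntE IntI empty_iff)
  then obtain e where e: "\<And>u. u \<in> K \<Longrightarrow> e u > 0"
    "\<And>u. u \<in> K \<Longrightarrow> AE \<omega> in M. \<not> (\<exists>\<^sub>F n in sequentially. sgn (walk Xs n \<omega>) \<in> ball u (e u))"
    by metis
  have "compact K" unfolding K_def using assms(1) by (simp add: closed_Int_compact)
  moreover have "K \<subseteq> (\<Union>u\<in>K. ball u (e u))" using e(1) by force
  ultimately obtain F where F: "F \<subseteq> K" "finite F" "K \<subseteq> (\<Union>u\<in>F. ball u (e u))"
    by (rule compactE_image[OF _ open_ball])
  have "AE \<omega> in M. \<forall>u\<in>F. \<not> (\<exists>\<^sub>F n in sequentially. sgn (walk Xs n \<omega>) \<in> ball u (e u))"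
    using F e(2) by (intro AE_finite_allI) auto
  then show ?thesis
  proof (rule eventually_mono)
    fix \<omega>
    assume no: "\<forall>u\<in>F. \<not> (\<exists>\<^sub>F n in sequentially. sgn (walk Xs n \<omega>) \<in> ball u (e u))"
    have "\<exists>\<^sub>F n in sequentially. \<exists>u\<in>F. sgn (walk Xs n \<omega>) \<in> ball u (e u)"
      if "\<exists>\<^sub>F n in sequentially. sgn (walk Xs n \<omega>) \<in> C"
      using that
    proof (rule frequently_elim1)
      fix n assume "sgn (walk Xs n \<omega>) \<in> C"
      with assms(2) have "sgn (walk Xs n \<omega>) \<in> K"
        by (auto simp: K_def norm_sgn)
      with F(3) show "\<exists>u\<in>F. sgn (walk Xs n \<omega>) \<in> ball u (e u)" by blast
    qed
    with frequently_bex_finite[OF F(2)] no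
    show "\<not> (\<exists>\<^sub>F n in sequentially. sgn (walk Xs n \<omega>) \<in> C)" by fast
  qed
qed

section \<open>The set of almost surely recurrent directions\<close>

text \<open>
  A ball that is almost surely visited finitely often cannot contain an almost surely recurrent
  direction, so the balls of \<open>AE_not_visits_ball\<close> lie in the complement.
\<close>

lemma closed_as_recurrent_directions: "closed (as_recurrent_directions M Xs)"
proof -
  have "\<exists>e>0. ball u e \<subseteq> - as_recurrent_directions M Xs" if u: "u \<notin> as_recurrent_directions M Xs" for u
  proof (cases "u \<in> sphere 0 1")
    case True
    then obtain e where e: "e > 0"
      "AE \<omega> in M. \<not> (\<exists>\<^sub>F n in sequentially. sgn (walk Xs n \<omega>) \<in> ball u e)"
      using AE_not_visits_ball u by blast
    have "ball u e \<inter> as_recurrent_directions M Xs = {}"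
    proof (rule ccontr)
      assume "ball u e \<inter> as_recurrent_directions M Xs \<noteq> {}"
      then have "AE \<omega> in M. \<exists>\<^sub>F n in sequentially. sgn (walk Xs n \<omega>) \<in> ball u e"
        by (intro AE_visits_open) auto
      with e(2) have "AE \<omega> in M. False" by eventually_elim simp
      then show False by simp
    qed
    with e(1) show ?thesis by blast
  next
    case False
    then obtain e where "e > 0" "ball u e \<subseteq> - sphere 0 1"
      using open_contains_ball[of "- sphere 0 1"] by (metis ComplI closed_sphere open_Compl)
    then show ?thesis by (auto simp: as_recurrent_directions_def subset_eq)
  qed
  then have "open (- as_recurrent_directions M Xs)" by (auto simp: open_contains_ball)
  then show ?thesis by (simp add: closed_def)
qed

text \<open>
  Without almost surely recurrent directions, the sphere would almost surely be visited only
  finitely often, that is, the walk would be 0 from some time on. But a non-zero increment at time \<open>N + 1\<close>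
  prevents the walk from being 0 at both times \<open>N\<close> and \<open>N + 1\<close>, and its probability does
  not depend on \<open>N\<close>.
\<close>

lemma as_recurrent_directions_nonempty:
  assumes "measure \<mu> {0} < 1"
  shows "as_recurrent_directions M Xs \<noteq> {}"
proof
  assume "as_recurrent_directions M Xs = {}"
  then have "AE \<omega> in M. \<not> (\<exists>\<^sub>F n in sequentially. sgn (walk Xs n \<omega>) \<in> sphere 0 1)"
    by (intro AE_not_visits_closed) auto
  moreover have "sgn x \<in> sphere 0 1 \<longleftrightarrow> x \<noteq> 0" for x :: 'a by (simp add: norm_sgn)
  ultimately have ev: "AE \<omega> in M. \<not> (\<exists>\<^sub>F n in sequentially. walk Xs n \<omega> \<noteq> 0)"
    by (simp only:)
  define T where "T N = {\<omega> \<in> space M. \<exists>n\<ge>N. walk Xs n \<omega> \<noteq> 0}" for N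
  have sT [measurable]: "T N \<in> events" for N unfolding T_def by measurable
  have "1 - measure \<mu> {0} \<le> prob (T N)" for N
  proof -
    have [measurable]: "Xs (Suc N) \<in> borel_measurable M" by simp
    have "measure \<mu> {0} = prob {\<omega> \<in> space M. Xs (Suc N) \<omega> = 0}"
      using ident[of "Suc N", symmetric]
      by (simp add: measure_distr vimage_def Int_def conj_commute)
    then have "1 - measure \<mu> {0} = prob {\<omega> \<in> space M. Xs (Suc N) \<omega> \<noteq> 0}"
      by (subst prob_neg) auto
    also have "\<dots> \<le> prob (T N)"
    proof (rule finite_measure_mono)
      have "walk Xs (Suc N) \<omega> = walk Xs N \<omega> + Xs (Suc N) \<omega>" for \<omega>
        by (simp add: walk_def)
      then show "{\<omega> \<in> space M. Xs (Suc N) \<omega> \<noteq> 0} \<subseteq> T N"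
        unfolding T_def by (smt (verit) Collect_mono add_0 le_refl le_SucI)
    qed simp
    finally show ?thesis .
  qed
  moreover have "(\<lambda>N. prob (T N)) \<longlonglongrightarrow> prob (\<Inter>N. T N)"
    by (intro finite_Lim_measure_decseq) (auto simp: decseq_def T_def intro: order_trans)
  ultimately have "1 - measure \<mu> {0} \<le> prob (\<Inter>N. T N)"
    by (intro LIMSEQ_le_const) auto
  moreover have "prob (\<Inter>N. T N) = 0"
    using ev by (subst prob_eq_0) (auto simp: T_def frequently_sequentially elim!: eventually_mono)
  ultimately show False using assms by simp
qed

lemma prob_recurrent_directions_eq:
  "prob {\<omega> \<in> space M. recurrent_directions Xs \<omega> = as_recurrent_directions M Xs} = 1"
proof -
  let ?D = "as_recurrent_directions M Xs"
  let ?visits = "\<lambda>\<omega> B. \<exists>\<^sub>F n in sequentially. sgn (walk Xs n \<omega>) \<in> closure B"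
  obtain \<B> :: "'a set set" where \<B>: "countable \<B>" "topological_basis \<B>"
    using ex_countable_basis by blast
  have sgn: "sgn x \<in> insert 0 (sphere 0 1)" for x :: 'a by (simp add: norm_sgn)
  have iff: "recurrent_directions Xs \<omega> = ?D \<longleftrightarrow> (\<forall>B\<in>\<B>. (?D \<inter> B \<noteq> {} \<longrightarrow> ?visits \<omega> B) \<and>
      (0 \<notin> closure B \<and> ?D \<inter> closure B = {} \<longrightarrow> \<not> ?visits \<omega> B))" for \<omega>
  proof -
    have "0 \<notin> sphere (0 :: 'a) 1" "?D \<subseteq> sphere 0 1"
      by (auto simp: as_recurrent_directions_def)
    from accumulation_set_eq_iff[where s = "\<lambda>n. sgn (walk Xs n \<omega>)",
        OF \<B>(2) compact_sphere this(1) sgn closed_as_recurrent_directions this(2)]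
    show ?thesis unfolding recurrent_directions_def recurrent_direction_iff .
  qed
  have [measurable]: "Measurable.pred M (\<lambda>\<omega>. ?visits \<omega> B)" for B
  proof -
    have [measurable]: "closure B \<in> sets borel" by (simp add: borel_closed)
    show ?thesis unfolding frequently_sequentially by measurable
  qed
  have meas: "{\<omega> \<in> space M. recurrent_directions Xs \<omega> = ?D} \<in> events"
    unfolding iff using \<B>(1) by measurable
  have "AE \<omega> in M. \<forall>B\<in>\<B>. (?D \<inter> B \<noteq> {} \<longrightarrow> ?visits \<omega> B) \<and>
      (0 \<notin> closure B \<and> ?D \<inter> closure B = {} \<longrightarrow> \<not> ?visits \<omega> B)"
  proof (intro AE_ball_countable'[OF _ \<B>(1)] AE_conjI AE_impI)
    fix B assume B: "B \<in> \<B>"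
    assume "?D \<inter> B \<noteq> {}"
    then have "AE \<omega> in M. \<exists>\<^sub>F n in sequentially. sgn (walk Xs n \<omega>) \<in> B"
      using topological_basis_open[OF \<B>(2) B] by (intro AE_visits_open) auto
    then show "AE \<omega> in M. ?visits \<omega> B"
      by (rule eventually_mono) (auto elim!: frequently_elim1 intro: closure_subset[THEN subsetD])
  next
    fix B assume "0 \<notin> closure B \<and> ?D \<inter> closure B = {}"
    then show "AE \<omega> in M. \<not> ?visits \<omega> B"
      by (intro AE_not_visits_closed) auto
  qed
  then have "AE \<omega> in M. recurrent_directions Xs \<omega> = ?D" unfolding iff .
  then show ?thesis using prob_Collect_eq_1[OF meas] by simp
qed

end

text \<open>
  If the increment vanished almost surely, its support would lie in \<open>{0}\<close>, hence in any
  subspace of codimension 1. In dimension 1 that subspace is \<open>{0}\<close> itself.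
\<close>

lemma genuinely_full_dim_imp_mass_at_0_less_1:
  fixes X :: "'w \<Rightarrow> 'a::euclidean_space"
  assumes "prob_space M" and X: "X \<in> borel_measurable M" and dim: "genuinely_full_dim M X"
  shows "measure (distr M borel X) {0} < 1"
proof (rule ccontr)
  interpret X: prob_space "distr M borel X" by (rule prob_space.prob_space_distr) fact+
  assume "\<not> measure (distr M borel X) {0} < 1"
  then have "measure (distr M borel X) (- {0}) = 0"
    using X.prob_compl[of "{0}"] X.prob_le_1[of "{0}"] by (simp add: Compl_eq_Diff_UNIV)
  then have "law_support M X \<subseteq> {0}"
    unfolding law_support_def by (force dest: spec[where x = "- {0}"])
  moreover obtain V :: "'a set" where "subspace V" "dim V = DIM('a) - 1"
    using choose_subspace_of_subspace[of "DIM('a) - 1" "UNIV :: 'a set"] by auto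
  ultimately show False
    using dim subspace_0[of V] unfolding genuinely_full_dim_def by blast
qed

theorem theorem2p1:
  fixes M :: "'w measure"
    and X :: "'w \<Rightarrow> real ^ 'd"
    and Xs :: "nat \<Rightarrow> 'w \<Rightarrow> real ^ 'd"
  assumes "prob_space M"
    and "X \<in> borel_measurable M"
    and "prob_space.indep_vars M (\<lambda>_. borel) Xs {1..}"
    and "\<And>k. k \<ge> 1 \<Longrightarrow> distr M borel (Xs k) = distr M borel X"
    and "genuinely_full_dim M X"
  shows "as_recurrent_directions M Xs \<noteq> {}
    \<and> closedin (top_of_set (sphere 0 1)) (as_recurrent_directions M Xs)
    \<and> measure M {\<omega> \<in> space M. recurrent_directions Xs \<omega> = as_recurrent_directions M Xs} = 1"
proof -
  interpret iid_walk M Xs "distr M borel X"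
    using assms(1,3,4) by (simp add: iid_walk_def iid_walk_axioms_def)
  have "as_recurrent_directions M Xs \<subseteq> sphere 0 1"
    by (auto simp: as_recurrent_directions_def)
  then show ?thesis
    using closed_subset[OF _ closed_as_recurrent_directions] prob_recurrent_directions_eq
      as_recurrent_directions_nonempty genuinely_full_dim_imp_mass_at_0_less_1[OF assms(1,2,5)]
    by blast
qed

end
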